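(* Let $L:(0,\infty)\to(0,\infty)$ be a nondecreasing function such that $$L(cy)\le 3cL(y)\ \text{ for all }c\ge1,\ y>0;\qquad L(y^2)\le 3L(y)\ \text{ for all }y\ge1;\qquad \int_1^\infty\frac{dx}{xL(x)}=\frac12.$$ Define $g(x)=x^{-1}\exp\{x^2/2\}\mathbb{1}(x\ge1)$. Let $h:[0,\infty)\to[0,\infty)$ be a nondecreasing function such that for some $x_0\ge1$ and $c>0$, $$0<h(x)\le c\,g(x)/L(x)\qquad\text{for all }x\ge x_0.$$ Let $q$ be a strictly increasing, continuous function on $[0,\infty)$ such that for some $\bar c\ge c$, $$L(x)\le q(x)\le\frac{\bar c\,g(x)}{h(x)}\qquad\text{for all }x\ge x_0.$$ Let $B>0$ and $A$ be random variables on a common probability space such that $E\exp\{\lambda A-\frac{\lambda^2}{2}B^2\}\le1$ for all $\lambda>0$. Then $$Eh(A^+/B)\le 4\bar c+h(x_0)+Eh\big(q^{-1}(L(B\vee B^{-1}))\big).$$ Consequently, $Eh(A^+/B)<\infty$ if $Eh\big(q^{-1}(L(B\vee B^{-1}))\big)<\infty$.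
   Context: $A^+=\max(A,0)$, $a\vee b=\max(a,b)$, and $\mathbb{1}(\cdot)$ is an indicator. $q^{-1}$ is the inverse function of $q$, with the convention $q^{-1}(y)=0$ for $y<q(0)$. *)

theory Defs
  imports "HOL-Probability.Probability"
begin

definition g_fun :: "real \<Rightarrow> real" where
  "g_fun x = inverse x * exp (x\<^sup>2 / 2) * indicator {1..} x"

text \<open>
  Inverse of a strictly increasing continuous function on \<open>[0, \<infinity>)\<close>,
  with the convention that it is \<open>0\<close> below \<open>q(0)\<close>. For unbounded such \<open>q\<close> the range of
  \<open>q\<close> on \<open>[0, \<infinity>)\<close> is \<open>[q(0), \<infinity>)\<close>, so the
  second branch is the genuine inverse.
\<close>
definition q_inv :: "(real \<Rightarrow> real) \<Rightarrow> real \<Rightarrow> real" where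
  "q_inv q y = (if y < q 0 then 0 else inv_into {0..} q y)"

end

theory Submission
  imports Defs
begin

text \<open>
  The proof is the method of mixtures. The condition on \<open>(A, B)\<close> says that the random variable
  \<open>exp (\<lambda> A - \<lambda>\<^sup>2 B\<^sup>2 / 2)\<close> has mean at most 1 for each
  fixed \<open>\<lambda> > 0\<close>. Heuristically the best \<open>\<lambda>\<close> is
  \<open>A / B\<^sup>2\<close>, where the exponent is \<open>x\<^sup>2 / 2\<close> with
  \<open>x = A / B\<close>; as this \<open>\<lambda>\<close> is random, one averages over all
  \<open>\<lambda>\<close> instead, with the probability density
  \<open>1 / (\<lambda> L (max \<lambda> (1/\<lambda>)))\<close>. The integral
  condition on \<open>L\<close> and its image under \<open>\<lambda> \<mapsto> 1/\<lambda>\<close> give total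
  mass 1 (\<open>nn_integral_mixing_density\<close>), so by Tonelli the average has mean at most 1
  (\<open>expectation_mixture_le_1\<close>).

  The average loses little at the random optimum. With \<open>u = \<lambda> B\<close> the exponent is
  \<open>x\<^sup>2 / 2 - (u - x)\<^sup>2 / 2\<close>, and the scale-invariant measure
  \<open>d\<lambda> / \<lambda>\<close> becomes \<open>du / u\<close>. On the unit interval
  \<open>x - 1 \<le> u \<le> x\<close> the growth conditions on \<open>L\<close> bound
  \<open>u L (max (u/B) (B/u))\<close> by
  \<open>3 x max (L x) (L (max B (1/B)))\<close> (\<open>weight_le\<close>).
  Hence, for \<open>x \<ge> 1\<close>, \<open>g x / max (L x) (L (max B (1/B)))\<close> is at most 4 times the average
  (\<open>mixture_lower_bound\<close>).

  What remains is a pointwise comparison. If \<open>x \<le> x0\<close>, then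
  \<open>h x \<le> h x0\<close>. If \<open>q x \<le> L (max B (1/B))\<close>, then \<open>x\<close> is at most
  the inverse of \<open>q\<close> at that value. In the remaining case both
  \<open>L x\<close> and \<open>L (max B (1/B)) < q x\<close> are at most a constant times
  \<open>g x / h x\<close>, which is exactly the bound of \<open>h x\<close> by the quantity controlled above.
\<close>

section \<open>The growth conditions and the mixing density\<close>

lemma max_inverse_ge_1: "b > 0 \<Longrightarrow> max b (inverse b) \<ge> (1::real)"
  by (cases "b \<ge> 1") (auto simp: le_max_iff_disj one_le_inverse_iff)

locale slow_growth =
  fixes L :: "real \<Rightarrow> real"
  assumes pos: "y > 0 \<Longrightarrow> L y > 0"
    and mono: "mono_on {0<..} L"
    and scale: "k \<ge> 1 \<Longrightarrow> y > 0 \<Longrightarrow> L (k * y) \<le> 3 * k * L y"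
    and square: "y \<ge> 1 \<Longrightarrow> L (y\<^sup>2) \<le> 3 * L y"
begin

lemma le: "0 < x \<Longrightarrow> x \<le> y \<Longrightarrow> L x \<le> L y"
  using mono by (auto simp: mono_on_def)

text \<open>
  A product of numbers at least 1 is at most the square of the larger factor, so the condition on
  squares controls products.
\<close>

lemma product_le:
  assumes "x \<ge> 1" "y \<ge> 1"
  shows "L (x * y) \<le> 3 * max (L x) (L y)"
proof -
  have "x * y \<le> (max x y)\<^sup>2"
    unfolding power2_eq_square using assms by (intro mult_mono) auto
  then have "L (x * y) \<le> L ((max x y)\<^sup>2)"
    using assms by (intro le) auto
  also have "\<dots> \<le> 3 * L (max x y)"
    using assms by (intro square) auto
  also have "\<dots> \<le> 3 * max (L x) (L y)"
    by (auto simp: max_def)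
  finally show ?thesis .
qed

definition mixing_density :: "real \<Rightarrow> real" where
  "mixing_density l = (if l > 0 then 1 / (l * L (max l (inverse l))) else 0)"

lemma mixing_density_nonneg: "mixing_density l \<ge> 0"
  using pos[of "max l (inverse l)"]
  by (auto simp: mixing_density_def less_max_iff_disj less_imp_le)

lemma mixing_density_measurable [measurable]: "mixing_density \<in> borel_measurable borel"
proof -
  define L' where "L' x = (if x > 0 then L x else 0)" for x
  have "mono L'"
    unfolding L'_def by (rule monoI) (auto intro: le less_imp_le pos)
  then have [measurable]: "L' \<in> borel_measurable borel"
    by (rule borel_measurable_mono)
  have "mixing_density = (\<lambda>l. if l > 0 then 1 / (l * L' (max l (inverse l))) else 0)"
    by (auto simp: mixing_density_def L'_def fun_eq_iff max_def)
  then show ?thesis by simp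
qed

text \<open>
  The inversion \<open>l \<mapsto> 1/l\<close> preserves \<open>dl / l\<close> and the weight
  \<open>L (max l (1/l))\<close>; it exchanges \<open>(0, 1]\<close> and \<open>[1, \<infinity>)\<close>, which
  therefore carry the same mass.
\<close>

lemma nn_integral_mixing_density:
  assumes "((\<lambda>x. 1 / (x * L x)) has_integral I) {1..}"
  shows "(\<integral>\<^sup>+ l. ennreal (mixing_density l) \<partial>lborel) = ennreal (2 * I)"
proof -
  have eq_upper: "mixing_density x = 1 / (x * L x)" if "x \<ge> 1" for x
  proof -
    have "inverse x \<le> x"
      using that by (smt (verit) inverse_le_1_iff)
    then show ?thesis using that by (simp add: mixing_density_def max_absorb1)
  qed
  have upper: "(mixing_density has_integral I) {1..}"
    using assms by (rule has_integral_eq[rotated]) (simp add: eq_upper)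
  have image: "inverse ` {1..} = {0<..1::real}"
  proof
    show "inverse ` {1..} \<subseteq> {0<..1::real}"
      by (auto simp: inverse_le_1_iff)
    show "{0<..1::real} \<subseteq> inverse ` {1..}"
    proof
      fix y :: real assume "y \<in> {0<..1}"
      then show "y \<in> inverse ` {1..}"
        by (intro image_eqI[of _ _ "inverse y"]) (auto simp: one_le_inverse_iff)
    qed
  qed
  have pullback: "\<bar>- (inverse x ^ Suc (Suc 0))\<bar> * mixing_density (inverse x) = mixing_density x"
    if "x \<in> {1..}" for x
  proof -
    have "L (max (inverse x) x) > 0" using that by (intro pos) auto
    then show ?thesis
      using that by (simp add: mixing_density_def max.commute field_simps)
  qed
  have der: "(inverse has_field_derivative - (inverse x ^ Suc (Suc 0))) (at x within {1..})"
    if "x \<in> {1..}" for x :: real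
    using that by (intro DERIV_inverse) auto
  have "mixing_density absolutely_integrable_on {1..} \<and> integral {1..} mixing_density = I"
    using upper mixing_density_nonneg
    by (auto intro: nonnegative_absolutely_integrable_1 has_integral_integrable integral_unique)
  then have "(\<lambda>x. \<bar>- (inverse x ^ Suc (Suc 0))\<bar> * mixing_density (inverse x))
               absolutely_integrable_on {1..}
      \<and> integral {1..} (\<lambda>x. \<bar>- (inverse x ^ Suc (Suc 0))\<bar> * mixing_density (inverse x)) = I"
    using pullback
    by (metis (no_types, lifting) absolutely_integrable_spike_eq[of "{}"] integral_cong
        negligible_empty Diff_empty)
  then have "mixing_density absolutely_integrable_on inverse ` {1..}
      \<and> integral (inverse ` {1..}) mixing_density = I"
    by (subst (asm) has_absolute_integral_change_of_variables_1'[OF _ der])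
       (auto intro: inj_onI)
  then have lower: "(mixing_density has_integral I) {0<..1}"
    unfolding image using has_integral_iff set_lebesgue_integral_eq_integral(1) by blast
  have "(mixing_density has_integral (I + I)) ({0<..1} \<union> {1..})"
  proof (rule has_integral_Un[OF lower upper])
    have "{0<..1::real} \<inter> {1..} = {1}" by auto
    then show "negligible ({0<..1::real} \<inter> {1..})" by simp
  qed
  also have "{0<..1::real} \<union> {1..} = {0<..}" by auto
  finally have "(\<integral>\<^sup>+ l. ennreal (indicator {0<..} l * mixing_density l) \<partial>lborel) = ennreal (I + I)"
    by (intro nn_integral_has_integral_lebesgue mixing_density_nonneg)
  also have "(\<lambda>l. indicator {0<..} l * mixing_density l) = mixing_density"
    by (auto simp: mixing_density_def indicator_def fun_eq_iff)
  finally show ?thesis by simp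
qed

section \<open>The mixture of the exponential moment bounds\<close>

definition mixture :: "real \<Rightarrow> real \<Rightarrow> ennreal" where
  "mixture a b =
     (\<integral>\<^sup>+ l. ennreal (exp (l * a - l\<^sup>2 / 2 * b\<^sup>2)) * ennreal (mixing_density l) \<partial>lborel)"

lemma mixture_measurable [measurable]:
  "(\<lambda>(a, b). mixture a b) \<in> borel_measurable (borel \<Otimes>\<^sub>M borel)"
  unfolding mixture_def by measurable

lemma expectation_mixture_le_1:
  assumes int: "((\<lambda>x. 1 / (x * L x)) has_integral 1 / 2) {1..}"
    and "prob_space M"
    and [measurable]: "A \<in> borel_measurable M" "B \<in> borel_measurable M"
    and canonical: "\<And>l. l > 0 \<Longrightarrow>
      (\<integral>\<^sup>+ \<omega>. ennreal (exp (l * A \<omega> - l\<^sup>2 / 2 * (B \<omega>)\<^sup>2)) \<partial>M) \<le> 1"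
  shows "(\<integral>\<^sup>+ \<omega>. mixture (A \<omega>) (B \<omega>) \<partial>M) \<le> 1"
proof -
  interpret prob_space M by fact
  interpret pair_sigma_finite lborel M ..
  have "(\<integral>\<^sup>+ \<omega>. mixture (A \<omega>) (B \<omega>) \<partial>M)
      = (\<integral>\<^sup>+ l. (\<integral>\<^sup>+ \<omega>. ennreal (exp (l * A \<omega> - l\<^sup>2 / 2 * (B \<omega>)\<^sup>2))
           * ennreal (mixing_density l) \<partial>M) \<partial>lborel)"
    unfolding mixture_def by (rule Fubini') measurable
  also have "\<dots> = (\<integral>\<^sup>+ l. (\<integral>\<^sup>+ \<omega>. ennreal (exp (l * A \<omega> - l\<^sup>2 / 2 * (B \<omega>)\<^sup>2)) \<partial>M)
           * ennreal (mixing_density l) \<partial>lborel)"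
    by (simp add: nn_integral_multc)
  also have "\<dots> \<le> (\<integral>\<^sup>+ l. ennreal (mixing_density l) \<partial>lborel)"
  proof (rule nn_integral_mono)
    fix l :: real
    show "(\<integral>\<^sup>+ \<omega>. ennreal (exp (l * A \<omega> - l\<^sup>2 / 2 * (B \<omega>)\<^sup>2)) \<partial>M)
           * ennreal (mixing_density l) \<le> ennreal (mixing_density l)"
    proof (cases "l > 0")
      case True
      show ?thesis using mult_right_mono[OF canonical[OF True]] by simp
    qed (simp add: mixing_density_def)
  qed
  also have "\<dots> = 1"
    using nn_integral_mixing_density[OF int] by simp
  finally show ?thesis .
qed

text \<open>
  For \<open>u \<ge> 1\<close> the argument of \<open>L\<close> is at most \<open>x * max b (inverse b)\<close>. For
  \<open>u < 1\<close> it may be as large as \<open>max b (inverse b) / u\<close>; the linear bound on the growth of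
  \<open>L\<close> then costs a factor \<open>1 / u\<close>, which the \<open>u\<close> in front compensates.
\<close>

lemma weight_le:
  assumes u: "0 < u" "u \<le> x" and x: "x \<ge> 1" and b: "b > 0"
  shows "u * L (max (u / b) (b / u)) \<le> 3 * x * max (L x) (L (max b (inverse b)))"
proof -
  define t where "t = max b (inverse b)"
  have t: "t \<ge> 1" "b \<le> t" "inverse b \<le> t"
    unfolding t_def using b by (auto intro: max_inverse_ge_1)
  have m: "L x \<le> max (L x) (L t)" "L t \<le> max (L x) (L t)" "L t > 0"
    using t by (auto intro: pos)
  have arg_pos: "max (u / b) (b / u) > 0" using u b by (simp add: less_max_iff_disj)
  have "u * L (max (u / b) (b / u)) \<le> x * (3 * max (L x) (L t))"
  proof (cases "u \<ge> 1")
    case True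
    have "u / b \<le> x * t"
      using u t b x unfolding divide_inverse by (intro mult_mono) auto
    moreover have "b / u \<le> x * t"
    proof -
      have "b / u \<le> b" using True b by (simp add: field_simps)
      also have "b \<le> x * t" using mult_mono[of 1 x b t] x t b by simp
      finally show ?thesis .
    qed
    ultimately have "L (max (u / b) (b / u)) \<le> L (x * t)"
      using arg_pos by (intro le) auto
    also have "\<dots> \<le> 3 * max (L x) (L t)"
      using x t by (intro product_le)
    finally show ?thesis
      using u x pos[OF arg_pos] by (intro mult_mono) auto
  next
    case False
    have "u / b \<le> inverse u * t"
    proof -
      have "u / b \<le> inverse b" using False u b by (simp add: field_simps)
      also have "\<dots> \<le> inverse u * t"
        using mult_mono[of 1 "inverse u" "inverse b" t] False u b t
        by (simp add: one_le_inverse_iff)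
      finally show ?thesis .
    qed
    moreover have "b / u \<le> inverse u * t"
      using t u by (simp add: field_simps)
    ultimately have "L (max (u / b) (b / u)) \<le> L (inverse u * t)"
      using arg_pos by (intro le) auto
    also have "\<dots> \<le> 3 * inverse u * L t"
      using False u t by (intro scale) (auto simp: one_le_inverse_iff)
    finally have "u * L (max (u / b) (b / u)) \<le> u * (3 * inverse u * L t)"
      using u by (intro mult_left_mono) auto
    also have "\<dots> = 1 * (3 * L t)"
      using u by simp
    also have "\<dots> \<le> x * (3 * max (L x) (L t))"
      using x m by (intro mult_mono) auto
    finally show ?thesis .
  qed
  then show ?thesis by (simp add: t_def)
qed

text \<open>
  On \<open>x - 1 \<le> l * b \<le> x\<close> the Gaussian factor is at least
  \<open>1 - (l * b - x)\<^sup>2 / 2\<close>, whose integral over this unit range is \<open>5/6\<close>.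
  Together with the factor 3 of \<open>weight_le\<close> this gives the constant \<open>18/5 \<le> 4\<close>.
\<close>

lemma mixture_lower_bound:
  assumes x: "x \<ge> 1" and b: "b > 0"
  shows "ennreal (g_fun x / max (L x) (L (max b (inverse b)))) \<le> 4 * mixture (x * b) b"
proof -
  define m where "m = max (L x) (L (max b (inverse b)))"
  have m: "m > 0" using pos[of x] x by (auto simp: m_def less_max_iff_disj)
  define K where "K = b * exp (x\<^sup>2 / 2) / (3 * x * m)"
  have K: "K > 0" using x b m by (simp add: K_def)
  define S where "S = {(x - 1) / b .. x / b}"
  define p where "p l = 1 - (l * b - x)\<^sup>2 / 2" for l
  define P where "P l = l - (l * b - x) ^ 3 / (6 * b)" for l
  have range: "x - 1 \<le> l * b" "l * b \<le> x" if "l \<in> S" for l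
    using that b by (auto simp: S_def field_simps)
  have p_nonneg: "p l \<ge> 0" if "l \<in> S" for l
  proof -
    have "(l * b - x)\<^sup>2 \<le> 1"
      using range[OF that] by (simp add: abs_square_le_1 abs_le_iff)
    then show ?thesis by (simp add: p_def)
  qed
  have P_diff: "P (x / b) - P ((x - 1) / b) = 5 / (6 * b)"
    using b by (simp add: P_def field_simps power3_eq_cube)
  have "ennreal (5 / (6 * b)) = (\<integral>\<^sup>+ l. ennreal (p l) * indicator S l \<partial>lborel)"
    unfolding P_diff[symmetric] S_def
  proof (rule nn_integral_FTC_Icc[symmetric])
    show "p \<in> borel_measurable borel" unfolding p_def by measurable
    show "(x - 1) / b \<le> x / b" using b by (simp add: field_simps)
    fix l assume l: "l \<in> {(x - 1) / b .. x / b}"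
    then show "0 \<le> p l" by (intro p_nonneg) (simp add: S_def)
    show "(P has_real_derivative p l) (at l)"
      unfolding P_def p_def using b
      by (auto intro!: derivative_eq_intros simp: field_simps)
  qed
  then have "ennreal K * ennreal (5 / (6 * b))
      = (\<integral>\<^sup>+ l. ennreal K * (ennreal (p l) * indicator S l) \<partial>lborel)"
    by (subst nn_integral_cmult) (auto simp: p_def S_def)
  also have "\<dots> \<le> mixture (x * b) b"
    unfolding mixture_def
  proof (rule nn_integral_mono_AE)
    \<comment> \<open>For \<open>x = 1\<close> the interval starts at \<open>l = 0\<close>, where the density vanishes.\<close>
    have bound: "ennreal K * (ennreal (p l) * indicator S l)
        \<le> ennreal (exp (l * (x * b) - l\<^sup>2 / 2 * b\<^sup>2)) * ennreal (mixing_density l)"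
      if "l \<noteq> 0" for l
    proof (cases "l \<in> S")
      case True
      define u where "u = l * b"
      have "0 \<le> l * b" using range(1)[OF True] x by linarith
      then have l: "l > 0" using b that by (simp add: zero_le_mult_iff)
      then have u: "0 < u" "u \<le> x" using b range(2)[OF True] by (auto simp: u_def)
      have lu: "l = u / b" "inverse l = b / u" using b l by (auto simp: u_def inverse_eq_divide)
      have "L (max (u / b) (b / u)) > 0"
        using u b by (intro pos) (simp add: less_max_iff_disj)
      then have "b / (3 * x * m) \<le> b / (u * L (max (u / b) (b / u)))"
        using weight_le[OF u x b, folded m_def] u b m x
        by (intro divide_left_mono mult_pos_pos) auto
      also have "\<dots> = mixing_density l"
        using l b unfolding mixing_density_def lu by simp
      finally have density: "b / (3 * x * m) \<le> mixing_density l" .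
      have exponent: "l * (x * b) - l\<^sup>2 / 2 * b\<^sup>2 = x\<^sup>2 / 2 + - ((l * b - x)\<^sup>2 / 2)"
        by (simp add: field_simps power2_eq_square)
      have "p l \<le> exp (- ((l * b - x)\<^sup>2 / 2))"
        using exp_ge_add_one_self[of "- ((l * b - x)\<^sup>2 / 2)"] by (simp add: p_def)
      then have "(exp (x\<^sup>2 / 2) * p l) * (b / (3 * x * m))
          \<le> exp (l * (x * b) - l\<^sup>2 / 2 * b\<^sup>2) * mixing_density l"
        unfolding exponent exp_add using density p_nonneg[OF True] x m b
        by (intro mult_mono) auto
      then have "K * p l \<le> exp (l * (x * b) - l\<^sup>2 / 2 * b\<^sup>2) * mixing_density l"
        by (simp add: K_def mult_ac)
      then show ?thesis
        using True K p_nonneg[OF True] mixing_density_nonneg[of l]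
        by (simp flip: ennreal_mult)
    qed simp
    show "AE l in lborel. ennreal K * (ennreal (p l) * indicator S l)
        \<le> ennreal (exp (l * (x * b) - l\<^sup>2 / 2 * b\<^sup>2)) * ennreal (mixing_density l)"
      using AE_lborel_singleton[of "0::real"] by eventually_elim (rule bound)
  qed
  finally have "4 * (ennreal K * ennreal (5 / (6 * b))) \<le> 4 * mixture (x * b) b"
    by (rule mult_left_mono) simp
  moreover have "ennreal (g_fun x / m) \<le> 4 * (ennreal K * ennreal (5 / (6 * b)))"
  proof -
    have "4 * (K * (5 / (6 * b))) = (10 / 9) * (g_fun x / m)"
      using x b m by (simp add: K_def g_fun_def field_simps)
    moreover have "g_fun x / m \<ge> 0" using x m by (simp add: g_fun_def)
    ultimately have "g_fun x / m \<le> 4 * (K * (5 / (6 * b)))" by linarith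
    then have "ennreal (g_fun x / m) \<le> ennreal (4 * (K * (5 / (6 * b))))"
      by (rule ennreal_leI)
    also have "\<dots> = 4 * (ennreal K * ennreal (5 / (6 * b)))"
      using K b by (simp only: ennreal_mult' ennreal_numeral less_imp_le zero_le_numeral)
    finally show ?thesis .
  qed
  ultimately show ?thesis unfolding m_def by order
qed

end

section \<open>The inverse function and the moment bound\<close>

text \<open>
  Above \<open>q 0\<close> the value of \<open>q_inv\<close> is meaningful only on the range of \<open>q\<close>. The
  point \<open>z\<close> guarantees by the intermediate value theorem that \<open>y\<close> lies in it.
\<close>

lemma q_inv_inverse:
  assumes cont: "continuous_on {0..} q" and z: "0 \<le> z" "y \<le> q z" and y: "q 0 \<le> y"
  shows "q_inv q y \<ge> 0" "q (q_inv q y) = y"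
proof -
  have "\<exists>w\<ge>0. w \<le> z \<and> q w = y"
    using z y continuous_on_subset[OF cont, of "{0..z}"] by (intro IVT') auto
  then have "y \<in> q ` {0..}" by auto
  then show "q_inv q y \<ge> 0" "q (q_inv q y) = y"
    using y inv_into_into[of y q "{0..}"] f_inv_into_f[of y q "{0..}"]
    by (auto simp: q_inv_def)
qed

lemma q_inv_mono:
  assumes mono: "strict_mono_on {0..} q" and cont: "continuous_on {0..} q"
    and z: "0 \<le> z" "y' \<le> q z" and y: "y \<le> y'"
  shows "q_inv q y \<le> q_inv q y'"
proof (cases "q 0 \<le> y")
  case True
  then show ?thesis
    using q_inv_inverse[OF cont z] q_inv_inverse[OF cont z(1), of y] y z
      strict_mono_on_leD[OF mono]
    by (metis atLeast_iff linorder_not_less order.trans strict_mono_onD[OF mono])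
next
  case False
  then show ?thesis
    using q_inv_inverse[OF cont z] by (auto simp: q_inv_def)
qed

lemma le_q_inv:
  assumes mono: "strict_mono_on {0..} q" and cont: "continuous_on {0..} q"
    and z: "0 \<le> z" "y \<le> q z" and x: "0 \<le> x" "q x \<le> y"
  shows "x \<le> q_inv q y"
proof -
  have "q 0 \<le> q x" using strict_mono_on_leD[OF mono] x by auto
  then have "q 0 \<le> y" using x by simp
  from q_inv_inverse[OF cont z this] show ?thesis
    using x strict_mono_onD[OF mono, of "q_inv q y" x] by force
qed

theorem theorem3p3:
  fixes M :: "'a measure"
    and A B :: "'a \<Rightarrow> real"
    and L h q :: "real \<Rightarrow> real"
    and x0 c cbar :: real
  assumes L_pos: "\<And>y. y > 0 \<Longrightarrow> L y > 0"
    and L_mono: "mono_on {0<..} L"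
    and L_scale: "\<And>k y. k \<ge> 1 \<Longrightarrow> y > 0 \<Longrightarrow> L (k * y) \<le> 3 * k * L y"
    and L_square: "\<And>y. y \<ge> 1 \<Longrightarrow> L (y\<^sup>2) \<le> 3 * L y"
    and L_integral: "((\<lambda>x. 1 / (x * L x)) has_integral 1 / 2) {1..}"
    and h_nonneg: "\<And>x. x \<ge> 0 \<Longrightarrow> h x \<ge> 0"
    and h_mono: "mono_on {0..} h"
    and x0: "x0 \<ge> 1"
    and c: "c > 0"
    and h_bound: "\<And>x. x \<ge> x0 \<Longrightarrow> 0 < h x \<and> h x \<le> c * g_fun x / L x"
    and q_mono: "strict_mono_on {0..} q"
    and q_cont: "continuous_on {0..} q"
    and cbar: "cbar \<ge> c"
    and q_bound: "\<And>x. x \<ge> x0 \<Longrightarrow> L x \<le> q x \<and> q x \<le> cbar * g_fun x / h x"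
    and M: "prob_space M"
    and A: "A \<in> borel_measurable M"
    and B: "B \<in> borel_measurable M"
    and B_pos: "AE \<omega> in M. B \<omega> > 0"
    and canonical: "\<And>l. l > 0 \<Longrightarrow>
      (\<integral>\<^sup>+ \<omega>. ennreal (exp (l * A \<omega> - l\<^sup>2 / 2 * (B \<omega>)\<^sup>2)) \<partial>M) \<le> 1"
  shows "(\<integral>\<^sup>+ \<omega>. ennreal (h (max (A \<omega>) 0 / B \<omega>)) \<partial>M)
           \<le> ennreal (4 * cbar) + ennreal (h x0)
             + (\<integral>\<^sup>+ \<omega>. ennreal (h (q_inv q (L (max (B \<omega>) (inverse (B \<omega>)))))) \<partial>M)
       \<and> ((\<integral>\<^sup>+ \<omega>. ennreal (h (q_inv q (L (max (B \<omega>) (inverse (B \<omega>)))))) \<partial>M) < \<infinity>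
           \<longrightarrow> (\<integral>\<^sup>+ \<omega>. ennreal (h (max (A \<omega>) 0 / B \<omega>)) \<partial>M) < \<infinity>)"
proof -
  interpret slow_growth L
    using L_pos L_mono L_scale L_square by unfold_locales
  define t where "t \<omega> = max (B \<omega>) (inverse (B \<omega>))" for \<omega>
  \<comment> \<open>The cut-off at 1 is invisible to \<open>t\<close>; it makes \<open>k\<close> monotone on the
    whole line and hence Borel, which additivity of the integral requires.\<close>
  define k where "k s = h (q_inv q (L (max 1 s)))" for s
  \<comment> \<open>As \<open>q\<close> dominates \<open>L\<close> from \<open>x0\<close> on, its range reaches every level
    \<open>L s\<close>.\<close>
  have range: "\<exists>z\<ge>0. L s \<le> q z" if "s \<ge> 1" for s
  proof (intro exI conjI)
    show "0 \<le> max s x0" using that by simp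
    have "L s \<le> L (max s x0)" using that by (intro le) auto
    also have "\<dots> \<le> q (max s x0)" using q_bound by auto
    finally show "L s \<le> q (max s x0)" .
  qed
  have q_inv_nonneg: "0 \<le> q_inv q (L s)" if "s \<ge> 1" for s
    using range[OF that] q_inv_inverse(1)[OF q_cont]
    by (cases "q 0 \<le> L s") (auto simp: q_inv_def)
  have h_le: "h x \<le> h y" if "0 \<le> x" "x \<le> y" for x y
    using h_mono that by (auto simp: mono_on_def)
  have k_nonneg: "k s \<ge> 0" for s
    unfolding k_def by (intro h_nonneg q_inv_nonneg) simp
  have "mono k"
  proof (rule monoI)
    fix s s' :: real assume "s \<le> s'"
    moreover obtain z where "z \<ge> 0" "L (max 1 s') \<le> q z"
      using range[of "max 1 s'"] by auto
    ultimately show "k s \<le> k s'"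
      unfolding k_def by (intro h_le q_inv_mono[OF q_mono q_cont] q_inv_nonneg le) auto
  qed
  then have [measurable]: "k \<in> borel_measurable borel"
    by (rule borel_measurable_mono)
  note [measurable] = A B
  have [measurable]: "t \<in> borel_measurable M" unfolding t_def by measurable
  have k_t: "k (t \<omega>) = h (q_inv q (L (t \<omega>)))" if "B \<omega> > 0" for \<omega>
  proof -
    have "t \<omega> \<ge> 1" using that unfolding t_def by (rule max_inverse_ge_1)
    then show ?thesis by (simp add: k_def max_absorb2)
  qed

  have pointwise: "ennreal (h (max (A \<omega>) 0 / B \<omega>))
      \<le> ennreal (4 * cbar) * mixture (A \<omega>) (B \<omega>) + ennreal (h x0) + ennreal (k (t \<omega>))"
    if B_pos: "B \<omega> > 0" for \<omega>
  proof -
    define x where "x = max (A \<omega>) 0 / B \<omega>"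
    have x_nonneg: "x \<ge> 0" using B_pos by (simp add: x_def)
    have t: "t \<omega> \<ge> 1" using B_pos unfolding t_def by (rule max_inverse_ge_1)
    consider "x \<le> x0" | "x > x0" "q x \<le> L (t \<omega>)" | "x > x0" "L (t \<omega>) < q x"
      by linarith
    then show ?thesis
    proof cases
      case 1
      then have "ennreal (h x) \<le> ennreal (h x0)"
        using x_nonneg by (intro ennreal_leI h_le)
      then show ?thesis
        unfolding x_def by (simp add: add_increasing add_increasing2)
    next
      case 2
      obtain z where "z \<ge> 0" "L (t \<omega>) \<le> q z" using range[OF t] by auto
      with 2 have "x \<le> q_inv q (L (t \<omega>))"
        using x_nonneg by (intro le_q_inv[OF q_mono q_cont])
      then have "ennreal (h x) \<le> ennreal (k (t \<omega>))"
        unfolding k_t[OF B_pos] using x_nonneg by (intro ennreal_leI h_le)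
      then show ?thesis
        unfolding x_def by (simp add: add_increasing)
    next
      case 3
      define m where "m = max (L x) (L (t \<omega>))"
      have x1: "x \<ge> 1" using 3 x0 by simp
      have h_pos: "h x > 0" and Lx: "L x > 0"
        using h_bound 3 x1 by (auto intro: pos)
      have "h x * m \<le> cbar * g_fun x"
      proof -
        have "L x \<le> q x" "q x \<le> cbar * g_fun x / h x" using q_bound 3 by auto
        with 3 have "m \<le> cbar * g_fun x / h x" by (auto simp: m_def)
        then show ?thesis using h_pos by (simp add: field_simps)
      qed
      moreover have "m > 0" using Lx by (simp add: m_def less_max_iff_disj)
      ultimately have "h x \<le> cbar * (g_fun x / m)" by (simp add: field_simps)
      then have "ennreal (h x) \<le> ennreal cbar * ennreal (g_fun x / m)"
        using c cbar by (simp flip: ennreal_mult' add: ennreal_leI)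
      also have "\<dots> \<le> ennreal cbar * (4 * mixture (x * B \<omega>) (B \<omega>))"
        using mixture_lower_bound[OF x1 B_pos] unfolding m_def t_def
        by (intro mult_left_mono) auto
      also have "x * B \<omega> = A \<omega>"
        using x1 B_pos by (auto simp: x_def max_def field_simps split: if_splits)
      also have "ennreal cbar * (4 * mixture (A \<omega>) (B \<omega>))
          = ennreal (4 * cbar) * mixture (A \<omega>) (B \<omega>)"
        using c cbar by (simp add: ennreal_mult mult_ac)
      finally show ?thesis
        unfolding x_def by (simp add: add_increasing2 add.assoc)
    qed
  qed

  have [measurable]: "(\<lambda>\<omega>. mixture (A \<omega>) (B \<omega>)) \<in> borel_measurable M"
    using measurable_compose[OF measurable_Pair[OF A B] mixture_measurable] by simp
  interpret prob_space M by fact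
  have "(\<integral>\<^sup>+ \<omega>. ennreal (h (max (A \<omega>) 0 / B \<omega>)) \<partial>M)
      \<le> (\<integral>\<^sup>+ \<omega>. ennreal (4 * cbar) * mixture (A \<omega>) (B \<omega>) + ennreal (h x0)
            + ennreal (k (t \<omega>)) \<partial>M)"
  proof (rule nn_integral_mono_AE)
    show "AE \<omega> in M. ennreal (h (max (A \<omega>) 0 / B \<omega>))
      \<le> ennreal (4 * cbar) * mixture (A \<omega>) (B \<omega>) + ennreal (h x0) + ennreal (k (t \<omega>))"
      using B_pos by eventually_elim (rule pointwise)
  qed
  also have "\<dots> = ennreal (4 * cbar) * (\<integral>\<^sup>+ \<omega>. mixture (A \<omega>) (B \<omega>) \<partial>M) + ennreal (h x0)
      + (\<integral>\<^sup>+ \<omega>. ennreal (k (t \<omega>)) \<partial>M)"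
    by (simp add: nn_integral_add nn_integral_cmult emeasure_space_1)
  also have "(\<integral>\<^sup>+ \<omega>. ennreal (k (t \<omega>)) \<partial>M)
      = (\<integral>\<^sup>+ \<omega>. ennreal (h (q_inv q (L (max (B \<omega>) (inverse (B \<omega>)))))) \<partial>M)"
  proof (rule nn_integral_cong_AE)
    show "AE \<omega> in M. ennreal (k (t \<omega>))
      = ennreal (h (q_inv q (L (max (B \<omega>) (inverse (B \<omega>))))))"
      using B_pos by eventually_elim (simp only: k_t, simp only: t_def)
  qed
  also have "ennreal (4 * cbar) * (\<integral>\<^sup>+ \<omega>. mixture (A \<omega>) (B \<omega>) \<partial>M) \<le> ennreal (4 * cbar)"
    using mult_left_mono[OF expectation_mixture_le_1[OF L_integral M A B canonical],
        of "ennreal (4 * cbar)"] by simp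
  finally have bound: "(\<integral>\<^sup>+ \<omega>. ennreal (h (max (A \<omega>) 0 / B \<omega>)) \<partial>M)
      \<le> ennreal (4 * cbar) + ennreal (h x0)
        + (\<integral>\<^sup>+ \<omega>. ennreal (h (q_inv q (L (max (B \<omega>) (inverse (B \<omega>)))))) \<partial>M)"
    by (simp add: add_right_mono)
  then show ?thesis
    by (auto intro: le_less_trans simp: less_top)
qed

end
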